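(* Let $p\in[1,2]$, $\gamma>0$, $d\ge1$, $L,R>0$, $0<\varepsilon\le LR^2$, and consider uniform fidelity $\delta_k=\delta$, so that the wall-clock time of $N$ iterations is $T=N\delta^{-\gamma}$. Let $0\le\mu\le L$ and let the error bound of the intermediate gradient method with forward-difference gradient estimates under adversarial noise be $$\mathcal{E}(N,\delta,\Theta)=\begin{cases}LR^2\exp\left(-\left(\frac\mu L\right)^{1/p}N\right)+\left(\frac L\mu\right)^{\frac{2p-1}{p}}d\,\delta,&\mu>0,\\[2mm]\frac{LR^2}{N^p}+\sqrt{d\delta L}\,\tilde R_N+N^{p-1}d\,\delta,&\mu=0,\end{cases}$$ where $\tilde R_N=O(R)$. Then the wall-clock time complexity required to achieve $\mathcal{E}(N,\delta,\Theta)\le\varepsilon$, i.e. the minimum of $N\delta^{-\gamma}$ over integers $N\ge1$ and $\delta>0$ with $\mathcal{E}(N,\delta,\Theta)\le\varepsilon$, is $$T_{\mathrm{total}}=\begin{cases}\tilde O\left(\left(\frac L\mu\right)^{\frac1p(1-\gamma)+2\gamma}\left(\frac\varepsilon d\right)^{-\gamma}\right),&\mu>0,\\[2mm]O\left(\left(\frac{\varepsilon}{9d}\right)^{-\gamma}\left(\frac{3LR^2}{\varepsilon}\right)^{\gamma+\frac1p}\right),&\mu=0.\end{cases}$$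
   Context: Setting: $f:\mathbb{R}^d\to\mathbb{R}$ is $L$-smooth and $\mu$-strongly convex (convex if $\mu=0$) with minimizer $x^*$, $R=\|x_0-x^*\|$. The oracle returns $\hat f(x)=f(x)+\xi(x)$ with $\xi$ an unknown deterministic function, $|\xi(x)|\le\delta$ (adversarial noise), at cost $c(\delta)=\delta^{-\gamma}$. The gradient estimate is $g(x,h)=\frac1h\sum_{k=1}^d(\hat f(x+he^k)-\hat f(x))e^k$ with $\{e^k\}$ an orthonormal basis and $h=2\sqrt{\delta/L}$ (its error is at most $2\sqrt{d\delta L}$); the queries in one iteration are counted as one unit of cost $c(\delta)$ (parallel queries). The parameter $p\in[1,2]$ selects the method ($p=1$: gradient method, $p=2$: fast gradient method), and $\tilde R_N=\max_{k\le N-1}\|x^k-x^*\|_2$; $\Theta$ collects hyperparameters. $O$ hides constants depending only on $p$, $\gamma$ (and the constant in $\tilde R_N=O(R)$); $\tilde O$ additionally hides logarithmic factors in $2LR^2/\varepsilon$. *)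

theory Defs
  imports "HOL-Analysis.L2_Norm"
begin

text \<open>
  The hidden constants must be uniform in the dimension \<open>d\<close>, so \<open>d\<close> is a natural number and not a
  type: a vector of $\mathbb{R}^d$ is a function \<open>nat \<Rightarrow> real\<close> of which only the coordinates
  below \<open>d\<close> are used.
\<close>

definition edist :: "nat \<Rightarrow> (nat \<Rightarrow> real) \<Rightarrow> (nat \<Rightarrow> real) \<Rightarrow> real"
  where "edist d u v = L2_set (\<lambda>i. u i - v i) {..<d}"

text \<open>For \<open>N = 0\<close> this is a maximum over the empty set; only \<open>N \<ge> 1\<close> is ever used.\<close>

definition R_tilde :: "nat \<Rightarrow> (nat \<Rightarrow> real) \<Rightarrow> (nat \<Rightarrow> nat \<Rightarrow> real) \<Rightarrow> nat \<Rightarrow> real"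
  where "R_tilde d xstar x N = Max ((\<lambda>k. edist d (x k) xstar) ` {..<N})"

text \<open>
  The iterates are those of a run with \<open>N\<close> iterations at fidelity \<open>\<delta>\<close> and other hyperparameters
  fixed, so \<open>\<R>\<close>, the quantity \<open>R_tilde\<close> of that run, is a function of both \<open>N\<close> and \<open>\<delta>\<close>.
\<close>

definition error_bound ::
    "real \<Rightarrow> nat \<Rightarrow> real \<Rightarrow> real \<Rightarrow> real \<Rightarrow> (nat \<Rightarrow> real \<Rightarrow> real) \<Rightarrow> nat \<Rightarrow> real \<Rightarrow> real"
  where "error_bound p d L \<mu> R \<R> N \<delta> =
    (if \<mu> > 0
     then L * R\<^sup>2 * exp (- ((\<mu> / L) powr (1 / p) * real N))
          + (L / \<mu>) powr ((2 * p - 1) / p) * real d * \<delta>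
     else L * R\<^sup>2 / real N powr p + sqrt (real d * \<delta> * L) * \<R> N \<delta>
          + real N powr (p - 1) * real d * \<delta>)"

definition wall_clock_time :: "real \<Rightarrow> nat \<Rightarrow> real \<Rightarrow> real"
  where "wall_clock_time \<gamma> N \<delta> = real N * \<delta> powr (- \<gamma>)"

definition feasible_times :: "real \<Rightarrow> (nat \<Rightarrow> real \<Rightarrow> real) \<Rightarrow> real \<Rightarrow> real set"
  where "feasible_times \<gamma> E \<epsilon> = {wall_clock_time \<gamma> N \<delta> | N \<delta>. N \<ge> 1 \<and> \<delta> > 0 \<and> E N \<delta> \<le> \<epsilon>}"

text \<open>
  An infimum, because without regularity of \<open>R_tilde\<close> in \<open>\<delta>\<close> the minimum need not be attained.
\<close>

definition T_total :: "real \<Rightarrow> (nat \<Rightarrow> real \<Rightarrow> real) \<Rightarrow> real \<Rightarrow> real"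
  where "T_total \<gamma> E \<epsilon> = Inf (feasible_times \<gamma> E \<epsilon>)"

end

theory Submission
  imports Defs "HOL-Analysis.Elementary_Metric_Spaces"
begin

text \<open>
  Writing \<open>s = L R\<^sup>2 / \<epsilon> \<ge> 1\<close>, it suffices to split the accuracy \<open>\<epsilon>\<close> evenly among the terms of the
  error bound and to read off one feasible pair \<open>(N, \<delta>)\<close>. In the strongly convex case the first
  term drops to \<open>\<epsilon> / 2\<close> once \<open>N\<close> reaches \<open>(L / \<mu>) powr (1 / p) * ln (2 * s)\<close>, and the noise term
  equals \<open>\<epsilon> / 2\<close> for \<open>\<delta>\<close> proportional to \<open>\<epsilon> / d\<close> divided by \<open>(L / \<mu>) powr ((2 * p - 1) / p)\<close>; the
  two powers of \<open>L / \<mu>\<close> combine in \<open>N * \<delta> powr (- \<gamma>)\<close> to the stated exponent, and the hidden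
  logarithm has power one (\<open>strongly_convex_feasible\<close>). In the convex case the first term forces
  \<open>N\<close> to be about \<open>(3 * s) powr (1 / p)\<close>. The second term then asks for
  \<open>\<delta> \<lesssim> \<epsilon>\<^sup>2 / (d L R\<^sup>2)\<close>, that is \<open>\<delta> \<lesssim> \<epsilon> / (d s)\<close>, and since \<open>N powr (p - 1)\<close> grows no
  faster than \<open>s\<close>, the third term asks for nothing stronger up to constants
  (\<open>convex_feasible\<close>). Rounding \<open>N\<close> up to an integer costs a constant factor, because \<open>s \<ge> 1\<close> and
  \<open>L / \<mu> \<ge> 1\<close> keep the real value of \<open>N\<close> away from zero.

  When the error bound is continuous in \<open>\<delta>\<close>, which is automatic in the strongly convex case, the
  infimum is attained by compactness (\<open>T_total_attained\<close>). The noise term bounds the feasible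
  \<open>\<delta>\<close> from above, hence the cost of one iteration from below, so only finitely many \<open>N\<close> can
  compete with a given feasible time; that time also bounds the competing \<open>\<delta>\<close> away from zero, and on
  the resulting compact interval the accuracy condition is closed.
\<close>

section \<open>Compactness of the competing times\<close>

lemma wall_clock_time_nonneg: "0 \<le> wall_clock_time \<gamma> N \<delta>"
  by (simp add: wall_clock_time_def)

lemma T_total_le:
  assumes "t \<in> feasible_times \<gamma> E \<epsilon>"
  shows "T_total \<gamma> E \<epsilon> \<le> t"
  unfolding T_total_def
proof (rule cInf_lower[OF assms])
  show "bdd_below (feasible_times \<gamma> E \<epsilon>)"
    by (rule bdd_belowI[of _ 0]) (auto simp: feasible_times_def wall_clock_time_nonneg)
qed

text \<open>
  An upper bound \<open>M\<close> on the feasible \<open>\<delta>\<close> confines the search to finitely many compact intervals: a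
  competitor of a feasible time \<open>T\<close> has \<open>N \<le> T * M powr \<gamma>\<close> because \<open>\<delta> powr (- \<gamma>) \<ge> M powr (- \<gamma>)\<close>, and
  \<open>\<delta> \<ge> T powr (- 1 / \<gamma>)\<close> because \<open>N \<ge> 1\<close>.
\<close>

lemma T_total_attained:
  assumes \<gamma>: "\<gamma> > 0"
    and cont: "\<And>N. N \<ge> 1 \<Longrightarrow> continuous_on {0<..} (E N)"
    and bound: "\<And>N \<delta>. N \<ge> 1 \<Longrightarrow> \<delta> > 0 \<Longrightarrow> E N \<delta> \<le> \<epsilon> \<Longrightarrow> \<delta> \<le> M"
    and nonempty: "feasible_times \<gamma> E \<epsilon> \<noteq> {}"
  shows "T_total \<gamma> E \<epsilon> \<in> feasible_times \<gamma> E \<epsilon>"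
proof -
  obtain N0 \<delta>0 where N0: "N0 \<ge> 1" and \<delta>0: "\<delta>0 > 0" and E0: "E N0 \<delta>0 \<le> \<epsilon>"
    using nonempty by (auto simp: feasible_times_def)
  define T where "T = wall_clock_time \<gamma> N0 \<delta>0"
  define m where "m = T powr (- 1 / \<gamma>)"
  define B where "B = nat \<lfloor>T * M powr \<gamma>\<rfloor>"
  have T: "T > 0"
    using N0 \<delta>0 by (simp add: T_def wall_clock_time_def)
  have m: "m > 0"
    using T by (simp add: m_def)
  have M: "M > 0"
    using bound[OF N0 \<delta>0 E0] \<delta>0 by linarith
  define S where "S = (\<Union>N\<in>{1..B}. wall_clock_time \<gamma> N ` {\<delta> \<in> {m..M}. E N \<delta> \<le> \<epsilon>})"
  have compact_S: "compact S"
    unfolding S_def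
  proof (intro compact_UN finite_atLeastAtMost compact_continuous_image)
    fix N assume "N \<in> {1..B}"
    then have N: "N \<ge> 1" by simp
    have "continuous_on {m..M} (E N)"
      by (rule continuous_on_subset[OF cont[OF N]]) (use m in auto)
    then have "closed {\<delta> \<in> {m..M}. E N \<delta> \<le> \<epsilon>}"
      by (intro continuous_on_closed_Collect_le) auto
    then have "compact ({m..M} \<inter> {\<delta> \<in> {m..M}. E N \<delta> \<le> \<epsilon>})"
      by (intro compact_Int_closed compact_Icc)
    then show "compact {\<delta> \<in> {m..M}. E N \<delta> \<le> \<epsilon>}"
      by (rule back_subst[of compact]) blast
    show "continuous_on {\<delta> \<in> {m..M}. E N \<delta> \<le> \<epsilon>} (wall_clock_time \<gamma> N)"
      unfolding wall_clock_time_def using m by (intro continuous_intros) auto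
  qed
  have S_feasible: "S \<subseteq> feasible_times \<gamma> E \<epsilon>"
    unfolding S_def feasible_times_def using m by fastforce
  have competitor_in_S: "wall_clock_time \<gamma> N \<delta> \<in> S"
    if N: "N \<ge> 1" and \<delta>: "\<delta> > 0" and E: "E N \<delta> \<le> \<epsilon>" and le: "wall_clock_time \<gamma> N \<delta> \<le> T" for N \<delta>
  proof -
    have \<delta>M: "\<delta> \<le> M" using bound[OF N \<delta> E] .
    have "1 * \<delta> powr (- \<gamma>) \<le> real N * \<delta> powr (- \<gamma>)"
      using N by (intro mult_right_mono) auto
    then have "\<delta> powr (- \<gamma>) \<le> T"
      using le by (simp add: wall_clock_time_def)
    then have "T powr (- 1 / \<gamma>) \<le> (\<delta> powr (- \<gamma>)) powr (- 1 / \<gamma>)"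
      using \<gamma> \<delta> by (intro powr_mono2') auto
    also have "\<dots> = \<delta>"
      using \<gamma> \<delta> by (simp add: powr_powr)
    finally have m\<delta>: "m \<le> \<delta>" by (simp add: m_def)
    have "real N * M powr (- \<gamma>) \<le> real N * \<delta> powr (- \<gamma>)"
      using \<gamma> \<delta> \<delta>M by (intro mult_left_mono powr_mono2') auto
    also have "\<dots> \<le> T" using le by (simp add: wall_clock_time_def)
    finally have "real N \<le> T * M powr \<gamma>"
      using M by (simp add: powr_minus field_simps)
    then have "N \<le> B"
      by (simp add: B_def le_nat_floor)
    then show ?thesis
      unfolding S_def using N E m\<delta> \<delta>M by auto
  qed
  have "S \<noteq> {}"
    using competitor_in_S[OF N0 \<delta>0 E0] by (auto simp: T_def)
  then obtain t where t: "t \<in> S" and t_min: "\<And>u. u \<in> S \<Longrightarrow> t \<le> u"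
    using compact_attains_inf[OF compact_S] by blast
  have "t \<le> T"
    using t_min competitor_in_S[OF N0 \<delta>0 E0] by (simp add: T_def)
  then have "t \<le> u" if "u \<in> feasible_times \<gamma> E \<epsilon>" for u
    using that t_min competitor_in_S unfolding feasible_times_def
    by (cases "u \<le> T") auto
  then have "T_total \<gamma> E \<epsilon> = t"
    unfolding T_total_def using t S_feasible by (intro cInf_eq_minimum) auto
  then show ?thesis
    using t S_feasible by auto
qed

section \<open>The error bound as a function of the fidelity\<close>

lemma R_tilde_nonneg:
  assumes "N \<ge> 1"
  shows "0 \<le> R_tilde d xstar x N"
proof -
  have "edist d (x 0) xstar \<le> R_tilde d xstar x N"
    unfolding R_tilde_def using assms by (intro Max_ge) auto
  then show ?thesis
    by (rule order_trans[rotated]) (simp add: edist_def)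
qed

lemma continuous_on_error_bound:
  assumes "\<mu> > 0 \<or> continuous_on {0<..} (\<R> N)"
  shows "continuous_on {0<..} (error_bound p d L \<mu> R \<R> N)"
proof (cases "\<mu> > 0")
  case True
  then show ?thesis
    unfolding error_bound_def by (auto intro!: continuous_intros)
next
  case False
  then show ?thesis
    using assms unfolding error_bound_def by (auto intro!: continuous_intros)
qed

text \<open>
  In both cases the last term of the error bound is at least \<open>d * \<delta>\<close>: its other factor is a power,
  with nonnegative exponent, of \<open>L / \<mu> \<ge> 1\<close> or of \<open>N \<ge> 1\<close>.
\<close>

lemma fidelity_le_of_error_bound_le:
  assumes p: "1 \<le> p" and d: "d \<ge> 1" and L: "L > 0" and \<mu>: "\<mu> \<le> L"
    and N: "N \<ge> 1" and \<delta>: "\<delta> > 0" and \<R>: "0 \<le> \<R> N \<delta>"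
    and le: "error_bound p d L \<mu> R \<R> N \<delta> \<le> \<epsilon>"
  shows "\<delta> \<le> \<epsilon> / real d"
proof -
  have "1 * (real d * \<delta>) \<le> error_bound p d L \<mu> R \<R> N \<delta>"
  proof (cases "\<mu> > 0")
    case True
    have "1 * (real d * \<delta>) \<le> (L / \<mu>) powr ((2 * p - 1) / p) * (real d * \<delta>)"
      using True p \<mu> \<delta> by (intro mult_right_mono ge_one_powr_ge_zero) auto
    moreover have "0 \<le> L * R\<^sup>2 * exp (- ((\<mu> / L) powr (1 / p) * real N))"
      using L by simp
    ultimately show ?thesis
      using True by (simp add: error_bound_def mult.assoc)
  next
    case False
    have "1 * (real d * \<delta>) \<le> real N powr (p - 1) * (real d * \<delta>)"
      using p N \<delta> by (intro mult_right_mono ge_one_powr_ge_zero) auto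
    moreover have "0 \<le> L * R\<^sup>2 / real N powr p" "0 \<le> sqrt (real d * \<delta> * L) * \<R> N \<delta>"
      using L \<R> \<delta> by auto
    ultimately show ?thesis
      using False by (simp add: error_bound_def mult.assoc)
  qed
  then show ?thesis
    using le d by (simp add: field_simps)
qed

section \<open>Feasible iteration numbers and fidelities\<close>

lemma ex_nat_ceiling:
  fixes y :: real
  assumes "y > 0"
  obtains N :: nat where "N \<ge> 1" "y \<le> real N" "real N \<le> y + 1"
proof
  show "nat \<lceil>y\<rceil> \<ge> 1" "y \<le> real (nat \<lceil>y\<rceil>)" "real (nat \<lceil>y\<rceil>) \<le> y + 1"
    using assms by linarith+
qed

text \<open>
  Half of the accuracy goes to the optimization error and half to the noise. The constant \<open>3\<close> pays
  for rounding: the real value of \<open>N\<close> is at least \<open>ln 2 \<ge> 1 / 2\<close>, so adding one at most triples it.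
\<close>

lemma strongly_convex_feasible:
  assumes p: "1 \<le> p" and d: "d \<ge> 1" and \<mu>: "0 < \<mu>" "\<mu> \<le> L"
    and R: "R > 0" and \<epsilon>: "0 < \<epsilon>" "\<epsilon> \<le> L * R\<^sup>2"
  shows "\<exists>t \<in> feasible_times \<gamma> (error_bound p d L \<mu> R \<R>) \<epsilon>.
    t \<le> 3 * 2 powr \<gamma> * ((L / \<mu>) powr (1 / p * (1 - \<gamma>) + 2 * \<gamma>) * (\<epsilon> / real d) powr (- \<gamma>))
        * ln (2 * L * R\<^sup>2 / \<epsilon>)"
proof -
  define a where "a = (L / \<mu>) powr (1 / p)"
  define b where "b = (L / \<mu>) powr ((2 * p - 1) / p)"
  define l where "l = ln (2 * L * R\<^sup>2 / \<epsilon>)"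
  define \<delta> where "\<delta> = \<epsilon> / real d / (2 * b)"
  have L: "L > 0" using \<mu> by linarith
  have a: "a \<ge> 1"
    unfolding a_def using \<mu> p by (intro ge_one_powr_ge_zero) auto
  have b: "b > 0"
    unfolding b_def using \<mu> L by simp
  have \<delta>: "\<delta> > 0"
    using \<epsilon> d b by (simp add: \<delta>_def)
  have "1 / 2 \<le> ln (2 :: real)"
    using ln_add_one_self_le_self2[of "- (1/2) :: real"] by (simp add: ln_div)
  also have "\<dots> \<le> l"
    unfolding l_def using \<epsilon> L R by (subst ln_le_cancel_iff) (auto simp: field_simps)
  finally have l: "1 / 2 \<le> l" .
  have al: "1 / 2 \<le> a * l"
    using mult_mono[OF a l] a by simp
  then obtain N where N: "N \<ge> 1" "a * l \<le> real N" "real N \<le> a * l + 1"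
    using ex_nat_ceiling[of "a * l"] by auto
  have inverse_a: "(\<mu> / L) powr (1 / p) = 1 / a"
    unfolding a_def using \<mu> L by (simp add: powr_divide)
  have "l \<le> (\<mu> / L) powr (1 / p) * real N"
    unfolding inverse_a using N(2) a by (simp add: field_simps)
  then have "exp (- ((\<mu> / L) powr (1 / p) * real N)) \<le> exp (- l)"
    by simp
  also have "exp (- l) = \<epsilon> / (2 * L * R\<^sup>2)"
    unfolding l_def using \<epsilon> L R by (simp add: exp_minus)
  finally have "L * R\<^sup>2 * exp (- ((\<mu> / L) powr (1 / p) * real N)) \<le> L * R\<^sup>2 * (\<epsilon> / (2 * L * R\<^sup>2))"
    using L by (intro mult_left_mono) auto
  also have "\<dots> = \<epsilon> / 2"
    using L R by simp
  finally have "L * R\<^sup>2 * exp (- ((\<mu> / L) powr (1 / p) * real N)) \<le> \<epsilon> / 2" .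
  moreover have "b * real d * \<delta> = \<epsilon> / 2"
    using b d by (simp add: \<delta>_def)
  ultimately have E: "error_bound p d L \<mu> R \<R> N \<delta> \<le> \<epsilon>"
    using \<mu> by (simp add: error_bound_def b_def)
  have "real N \<le> 3 * (a * l)"
    using N(3) al by linarith
  then have "wall_clock_time \<gamma> N \<delta> \<le> 3 * (a * l) * \<delta> powr (- \<gamma>)"
    unfolding wall_clock_time_def by (intro mult_right_mono) auto
  also have "\<delta> powr (- \<gamma>) = 2 powr \<gamma> * b powr \<gamma> * (\<epsilon> / real d) powr (- \<gamma>)"
    unfolding \<delta>_def using \<epsilon> d b
    by (simp add: powr_divide powr_mult powr_minus divide_simps)
  also have "b powr \<gamma> = (L / \<mu>) powr (2 * \<gamma> - \<gamma> / p)"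
  proof -
    have "(2 * p - 1) / p * \<gamma> = 2 * \<gamma> - \<gamma> / p"
      using p by (simp add: field_simps)
    then show ?thesis by (simp add: b_def powr_powr)
  qed
  also have "3 * (a * l) * (2 powr \<gamma> * (L / \<mu>) powr (2 * \<gamma> - \<gamma> / p) * (\<epsilon> / real d) powr (- \<gamma>))
      = 3 * 2 powr \<gamma> * (a * (L / \<mu>) powr (2 * \<gamma> - \<gamma> / p) * (\<epsilon> / real d) powr (- \<gamma>)) * l"
    by (simp only: mult_ac)
  also have "a * (L / \<mu>) powr (2 * \<gamma> - \<gamma> / p) = (L / \<mu>) powr (1 / p * (1 - \<gamma>) + 2 * \<gamma>)"
  proof -
    have "1 / p + (2 * \<gamma> - \<gamma> / p) = 1 / p * (1 - \<gamma>) + 2 * \<gamma>"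
      using p by (simp add: field_simps)
    then show ?thesis by (simp only: a_def powr_add[symmetric])
  qed
  finally show ?thesis
    using N(1) \<delta> E unfolding feasible_times_def l_def by blast
qed

text \<open>
  Each of the three terms gets a third of the accuracy. With \<open>u = 3 L R\<^sup>2 / \<epsilon>\<close> and \<open>N\<close> between
  \<open>u powr (1 / p)\<close> and its double, \<open>N powr (p - 1) \<le> 2 * u\<close> because \<open>p - 1 \<le> 1\<close> and
  \<open>(p - 1) / p \<le> 1\<close>; the chosen \<open>\<delta>\<close> then meets the requirements of the second and of the third
  term at once.
\<close>

lemma convex_feasible:
  assumes p: "1 \<le> p" "p \<le> 2" and d: "d \<ge> 1" and L: "L > 0"
    and R: "R > 0" and \<epsilon>: "0 < \<epsilon>" "\<epsilon> \<le> L * R\<^sup>2"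
    and K: "K \<ge> 1" and \<R>: "\<And>N \<delta>. N \<ge> 1 \<Longrightarrow> \<delta> > 0 \<Longrightarrow> \<R> N \<delta> \<le> K * R"
  shows "\<exists>t \<in> feasible_times \<gamma> (error_bound p d L 0 R \<R>) \<epsilon>.
    t \<le> 2 * (2 * K\<^sup>2 / 3) powr \<gamma>
        * ((\<epsilon> / (9 * real d)) powr (- \<gamma>) * (3 * L * R\<^sup>2 / \<epsilon>) powr (\<gamma> + 1 / p))"
proof -
  define u where "u = 3 * L * R\<^sup>2 / \<epsilon>"
  \<comment> \<open>The third term allows \<open>\<delta>\<close> up to \<open>\<epsilon> / (6 d u)\<close> and the second up to \<open>\<epsilon> / (3 d K\<^sup>2 u)\<close>; this \<open>c\<close>
    makes \<open>\<delta> = \<epsilon> / (6 d K\<^sup>2 u)\<close>, which is below both since \<open>K \<ge> 1\<close>.\<close>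
  define c where "c = 2 * K\<^sup>2 / 3"
  define a where "a = u powr (1 / p)"
  define \<delta> where "\<delta> = \<epsilon> / (9 * real d) / (u * c)"
  have u: "u \<ge> 1"
    unfolding u_def using \<epsilon> by (simp add: field_simps)
  have c: "c > 0"
    using K by (simp add: c_def)
  have a: "a \<ge> 1"
    unfolding a_def using u p by (intro ge_one_powr_ge_zero) auto
  have \<delta>: "\<delta> > 0"
    using \<epsilon> d u c by (simp add: \<delta>_def)
  have LR: "L * R\<^sup>2 = \<epsilon> * u / 3"
    using \<epsilon> by (simp add: u_def)
  have d\<delta>: "real d * \<delta> = \<epsilon> / (6 * K\<^sup>2 * u)"
    using d by (simp add: \<delta>_def c_def)
  obtain N where N: "N \<ge> 1" "a \<le> real N" "real N \<le> a + 1"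
    using ex_nat_ceiling[of a] a by auto
  have N2: "real N \<le> 2 * a"
    using N(3) a by linarith

  have "u = a powr p"
    using u p by (simp add: a_def powr_powr)
  also have "\<dots> \<le> real N powr p"
    using a p N by (intro powr_mono2) auto
  finally have "L * R\<^sup>2 / real N powr p \<le> \<epsilon> / 3"
    using N(1) \<epsilon> by (simp add: LR divide_simps)
  moreover have "sqrt (real d * \<delta> * L) * \<R> N \<delta> \<le> \<epsilon> / 3"
  proof -
    have "sqrt (real d * \<delta> * L) * \<R> N \<delta> \<le> sqrt (real d * \<delta> * L) * (K * R)"
      using \<R>[OF N(1) \<delta>] \<delta> L by (intro mult_left_mono) auto
    also have "\<dots> \<le> \<epsilon> / 3"
    proof (rule power2_le_imp_le)
      have "(sqrt (real d * \<delta> * L) * (K * R))\<^sup>2 = real d * \<delta> * K\<^sup>2 * (L * R\<^sup>2)"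
        using \<delta> L by (simp add: power_mult_distrib)
      also have "\<dots> = \<epsilon>\<^sup>2 / 18"
        unfolding d\<delta> LR using K u by (simp add: power2_eq_square)
      also have "\<dots> \<le> (\<epsilon> / 3)\<^sup>2"
        by (simp add: power_divide)
      finally show "(sqrt (real d * \<delta> * L) * (K * R))\<^sup>2 \<le> (\<epsilon> / 3)\<^sup>2" .
    qed (use \<epsilon> in simp)
    finally show ?thesis .
  qed
  moreover have "real N powr (p - 1) * (real d * \<delta>) \<le> \<epsilon> / 3"
  proof -
    have "real N powr (p - 1) \<le> (2 * a) powr (p - 1)"
      using N2 p by (intro powr_mono2) auto
    also have "\<dots> = 2 powr (p - 1) * u powr (1 / p * (p - 1))"
      using a by (simp add: powr_mult a_def powr_powr)
    also have "\<dots> \<le> 2 powr 1 * u powr 1"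
      using p u by (intro mult_mono powr_mono) (auto simp: field_simps)
    finally have "real N powr (p - 1) \<le> 2 * u"
      using u by simp
    then have "real N powr (p - 1) * (real d * \<delta>) \<le> 2 * u * (real d * \<delta>)"
      using \<delta> by (intro mult_right_mono) auto
    also have "\<dots> = \<epsilon> / (3 * K\<^sup>2)"
      unfolding d\<delta> using u by simp
    also have "\<dots> \<le> \<epsilon> / (3 * 1)"
      using K \<epsilon> by (intro divide_left_mono mult_left_mono) auto
    finally show ?thesis by simp
  qed
  ultimately have E: "error_bound p d L 0 R \<R> N \<delta> \<le> \<epsilon>"
    unfolding error_bound_def by (simp only: mult.assoc less_irrefl if_False)
  have "wall_clock_time \<gamma> N \<delta> \<le> 2 * a * \<delta> powr (- \<gamma>)"
    unfolding wall_clock_time_def using N2 by (intro mult_right_mono) auto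
  also have "\<delta> powr (- \<gamma>) = (\<epsilon> / (9 * real d)) powr (- \<gamma>) * (u powr \<gamma> * c powr \<gamma>)"
  proof -
    have "\<delta> powr (- \<gamma>) = (\<epsilon> / (9 * real d)) powr (- \<gamma>) / (u * c) powr (- \<gamma>)"
      unfolding \<delta>_def using \<epsilon> u c by (intro powr_divide)
    also have "\<dots> = (\<epsilon> / (9 * real d)) powr (- \<gamma>) * (u * c) powr \<gamma>"
      by (simp add: powr_minus_divide)
    finally show ?thesis
      using u c by (simp add: powr_mult)
  qed
  also have "2 * a * ((\<epsilon> / (9 * real d)) powr (- \<gamma>) * (u powr \<gamma> * c powr \<gamma>))
      = 2 * c powr \<gamma> * ((\<epsilon> / (9 * real d)) powr (- \<gamma>) * u powr (\<gamma> + 1 / p))"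
    by (simp add: a_def powr_add)
  finally show ?thesis
    using N(1) \<delta> E unfolding feasible_times_def u_def c_def by blast
qed

section \<open>The wall-clock time complexity\<close>

theorem proposition4:
  fixes p \<gamma> K :: real
  assumes "1 \<le> p" and "p \<le> 2" and "\<gamma> > 0"
  shows "\<exists>(C::real) (q::nat). C > 0 \<and>
    (\<forall>(d::nat) (L::real) (\<mu>::real) (R::real) (\<epsilon>::real)
      (xstar :: nat \<Rightarrow> real) (x0 :: nat \<Rightarrow> real) (x :: nat \<Rightarrow> real \<Rightarrow> nat \<Rightarrow> nat \<Rightarrow> real)
      (\<R> :: nat \<Rightarrow> real \<Rightarrow> real) (E :: nat \<Rightarrow> real \<Rightarrow> real).
      d \<ge> 1 \<longrightarrow> L > 0 \<longrightarrow> 0 \<le> \<mu> \<longrightarrow> \<mu> \<le> L \<longrightarrow>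
      R = edist d x0 xstar \<longrightarrow> R > 0 \<longrightarrow> 0 < \<epsilon> \<longrightarrow> \<epsilon> \<le> L * R\<^sup>2 \<longrightarrow>
      (\<forall>N \<delta>. x N \<delta> 0 = x0) \<longrightarrow>
      \<R> = (\<lambda>N \<delta>. R_tilde d xstar (x N \<delta>) N) \<longrightarrow>
      (\<mu> = 0 \<longrightarrow> (\<forall>N\<ge>1. \<forall>\<delta>>0. \<R> N \<delta> \<le> K * R)) \<longrightarrow>
      E = error_bound p d L \<mu> R \<R> \<longrightarrow>
      feasible_times \<gamma> E \<epsilon> \<noteq> {} \<and>
      ((\<mu> > 0 \<or> (\<forall>N\<ge>1. continuous_on {0<..} (\<R> N))) \<longrightarrow>
        T_total \<gamma> E \<epsilon> \<in> feasible_times \<gamma> E \<epsilon>) \<and>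
      T_total \<gamma> E \<epsilon> \<le>
        (if \<mu> > 0
         then C * ((L / \<mu>) powr (1 / p * (1 - \<gamma>) + 2 * \<gamma>) * (\<epsilon> / real d) powr (- \<gamma>))
                * ln (2 * L * R\<^sup>2 / \<epsilon>) ^ q
         else C * ((\<epsilon> / (9 * real d)) powr (- \<gamma>) * (3 * L * R\<^sup>2 / \<epsilon>) powr (\<gamma> + 1 / p))))"
proof -
  \<comment> \<open>Enlarging \<open>K\<close> to at least one preserves the bound on \<open>\<R>\<close>.\<close>
  define K' where "K' = max 1 K"
  define C where "C = max (3 * 2 powr \<gamma>) (2 * (2 * K'\<^sup>2 / 3) powr \<gamma>)"
  have C: "C > 0"
    unfolding C_def by (rule less_le_trans[OF _ max.cobounded1]) simp
  have claim: "feasible_times \<gamma> E \<epsilon> \<noteq> {} \<and>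
      ((\<mu> > 0 \<or> (\<forall>N\<ge>1. continuous_on {0<..} (\<R> N))) \<longrightarrow>
        T_total \<gamma> E \<epsilon> \<in> feasible_times \<gamma> E \<epsilon>) \<and>
      T_total \<gamma> E \<epsilon> \<le>
        (if \<mu> > 0
         then C * ((L / \<mu>) powr (1 / p * (1 - \<gamma>) + 2 * \<gamma>) * (\<epsilon> / real d) powr (- \<gamma>))
                * ln (2 * L * R\<^sup>2 / \<epsilon>) ^ 1
         else C * ((\<epsilon> / (9 * real d)) powr (- \<gamma>) * (3 * L * R\<^sup>2 / \<epsilon>) powr (\<gamma> + 1 / p)))"
    (is "_ \<and> _ \<and> _ \<le> ?bound")
    if d: "d \<ge> 1" and L: "L > 0" and \<mu>: "0 \<le> \<mu>" "\<mu> \<le> L" and R: "R > 0"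
      and \<epsilon>: "0 < \<epsilon>" "\<epsilon> \<le> L * R\<^sup>2"
      and \<R>: "\<R> = (\<lambda>N \<delta>. R_tilde d xstar (x N \<delta>) N)"
      and \<R>_le: "\<mu> = 0 \<longrightarrow> (\<forall>N\<ge>1. \<forall>\<delta>>0. \<R> N \<delta> \<le> K * R)"
      and E: "E = error_bound p d L \<mu> R \<R>"
    for d :: nat and L \<mu> R \<epsilon> :: real and xstar :: "nat \<Rightarrow> real"
      and x :: "nat \<Rightarrow> real \<Rightarrow> nat \<Rightarrow> nat \<Rightarrow> real" and \<R> E :: "nat \<Rightarrow> real \<Rightarrow> real"
  proof -
    have \<R>_nonneg: "0 \<le> \<R> N \<delta>" if "N \<ge> 1" for N \<delta>
      unfolding \<R> using that by (rule R_tilde_nonneg)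
    have "\<exists>t \<in> feasible_times \<gamma> E \<epsilon>. t \<le> ?bound"
    proof (cases "\<mu> > 0")
      case True
      let ?X = "(L / \<mu>) powr (1 / p * (1 - \<gamma>) + 2 * \<gamma>) * (\<epsilon> / real d) powr (- \<gamma>)"
      let ?l = "ln (2 * L * R\<^sup>2 / \<epsilon>)"
      obtain t where t: "t \<in> feasible_times \<gamma> E \<epsilon>" "t \<le> 3 * 2 powr \<gamma> * ?X * ?l"
        using strongly_convex_feasible[OF \<open>1 \<le> p\<close> d True \<mu>(2) R \<epsilon>] unfolding E by blast
      have "0 \<le> ?l"
        using \<epsilon> by (intro ln_ge_zero) (simp add: field_simps)
      then have "3 * 2 powr \<gamma> * ?X * ?l \<le> C * ?X * ?l"
        by (intro mult_right_mono) (auto simp: C_def)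
      then have "t \<le> ?bound"
        using t(2) True by simp
      then show ?thesis using t(1) by blast
    next
      case False
      then have \<mu>0: "\<mu> = 0" using \<mu> by simp
      let ?X = "(\<epsilon> / (9 * real d)) powr (- \<gamma>) * (3 * L * R\<^sup>2 / \<epsilon>) powr (\<gamma> + 1 / p)"
      have \<R>_le': "\<R> N \<delta> \<le> K' * R" if "N \<ge> 1" "\<delta> > 0" for N \<delta>
      proof -
        have "\<R> N \<delta> \<le> K * R" using \<R>_le \<mu>0 that by blast
        also have "\<dots> \<le> K' * R" using R by (intro mult_right_mono) (auto simp: K'_def)
        finally show ?thesis .
      qed
      have "K' \<ge> 1" by (simp add: K'_def)
      then obtain t where t: "t \<in> feasible_times \<gamma> E \<epsilon>" "t \<le> 2 * (2 * K'\<^sup>2 / 3) powr \<gamma> * ?X"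
        using convex_feasible[OF \<open>1 \<le> p\<close> \<open>p \<le> 2\<close> d L R \<epsilon>, where K = K' and \<R> = \<R> and \<gamma> = \<gamma>] \<R>_le'
        unfolding E \<mu>0 by blast
      have "2 * (2 * K'\<^sup>2 / 3) powr \<gamma> * ?X \<le> C * ?X"
        by (intro mult_right_mono) (auto simp: C_def)
      then have "t \<le> ?bound"
        using t(2) False by simp
      then show ?thesis using t(1) by blast
    qed
    then have nonempty: "feasible_times \<gamma> E \<epsilon> \<noteq> {}" and bound: "T_total \<gamma> E \<epsilon> \<le> ?bound"
      using T_total_le order_trans by blast+
    have "T_total \<gamma> E \<epsilon> \<in> feasible_times \<gamma> E \<epsilon>"
      if "\<mu> > 0 \<or> (\<forall>N\<ge>1. continuous_on {0<..} (\<R> N))"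
    proof (rule T_total_attained[OF \<open>\<gamma> > 0\<close> _ _ nonempty])
      show "continuous_on {0<..} (E N)" if "N \<ge> 1" for N
        unfolding E using \<open>\<mu> > 0 \<or> _\<close> that by (intro continuous_on_error_bound) blast
      show "\<delta> \<le> \<epsilon> / real d" if "N \<ge> 1" "\<delta> > 0" "E N \<delta> \<le> \<epsilon>" for N \<delta>
        using that \<R>_nonneg
        by (intro fidelity_le_of_error_bound_le[OF \<open>1 \<le> p\<close> d L \<mu>(2), of N \<delta> \<R> R \<epsilon>]) (auto simp: E)
    qed
    with nonempty bound show ?thesis by blast
  qed
  show ?thesis
    by (intro exI[of _ C] exI[of _ "1 :: nat"] conjI[OF C] allI impI) (rule claim; assumption)
qed

end
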